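(* Let $M$ and $D$ be categories and let $\mathrm{Inf}: M \to D$ be a functor with a left adjoint $\mathrm{Alg}: D \to M$. Then $\mathrm{Alg}$ is an error minimiser for any choice of error on $D$: for every object $d$ of $D$, the single object $\mathrm{Alg}(d)$ of $M$ is simultaneously a global error minimiser with respect to $d$ for every monoidal preorder $S$ whose identity 1-morphism $\mathrm{Id}_*$ is a bottom element and every $S$ flavoured error $\mathrm{Err}: D \to S$ on $D$.
   Context: A monoidal preorder $S$ is a (strict) 2-category with a single object $*$ and at most one 2-morphism between any pair of 1-morphisms; equivalently, its 1-morphisms form a monoid with unit $\mathrm{Id}_*$, carrying a preorder ($a \le b$ iff there is a 2-morphism $a \Rightarrow b$) for which multiplication is monotone in both variables. A bottom element is an element $\bot$ with $\bot \le a$ for all $a$. Given a monoidal preorder $S$ in which $\mathrm{Id}_*$ is a bottom element, an $S$ flavoured error on a category $D$ is a lax 2-functor $\mathrm{Err}: D \to S$, where $D$ is regarded as a 2-category with only identity 2-morphisms. Concretely, it assigns to every morphism $f$ of $D$ a 1-morphism $\mathrm{Err}(f)$ of $S$ such that $\mathrm{Err}(g)\mathrm{Err}(f) \le \mathrm{Err}(gf)$ for composable $f,g$ and $\mathrm{Id}_* \le \mathrm{Err}(\mathrm{Id}_x)$ for every object $x$ (the coherence conditions are automatic since $S$ has at most one 2-morphism between 1-morphisms). Error comparison: for objects $x,y,z,w$ of $D$, the notation $\mathrm{Err}(x,y) \le_S \mathrm{Err}(z,w)$ means that for every morphism $f: z \to w$ in $D$ there exists a morphism $g: x \to y$ in $D$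 and a 2-morphism $\mathrm{Err}(g) \Rightarrow \mathrm{Err}(f)$ in $S$ (i.e. $\mathrm{Err}(g) \le \mathrm{Err}(f)$). The symbol $\mathrm{Err}(x,y)$ by itself is only notation and not an element of $S$. Given $S$ and $\mathrm{Err}$, an object $x$ of $M$ is a global error minimiser with respect to $d$ if $\mathrm{Err}(d,\mathrm{Inf}(x)) \le_S \mathrm{Err}(d,\mathrm{Inf}(m))$ for every object $m$ of $M$. *)

theory Defs
  imports "HOL-Algebra.Group"
begin

section \<open>Categories, functors and adjunctions\<close>

record ('o, 'm) category_data =
  Ob :: "'o set"
  Mor :: "'m set"
  Dom :: "'m \<Rightarrow> 'o"
  Cod :: "'m \<Rightarrow> 'o"
  Idn :: "'o \<Rightarrow> 'm"
  Cmp :: "'m \<Rightarrow> 'm \<Rightarrow> 'm"  (infixl "\<odot>\<index>" 70)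

text \<open>
  \<open>g \<odot> f\<close> means ``first \<open>f\<close>, then \<open>g\<close>''. Its value is constrained only on
  composable pairs.
\<close>

definition Hom :: "('o, 'm, 'z) category_data_scheme \<Rightarrow> 'o \<Rightarrow> 'o \<Rightarrow> 'm set"
  where "Hom C x y = {f \<in> Mor C. Dom C f = x \<and> Cod C f = y}"

locale category =
  fixes C :: "('o, 'm, 'z) category_data_scheme" (structure)
  assumes Dom_closed: "f \<in> Mor C \<Longrightarrow> Dom C f \<in> Ob C"
    and Cod_closed: "f \<in> Mor C \<Longrightarrow> Cod C f \<in> Ob C"
    and Idn_closed: "x \<in> Ob C \<Longrightarrow> Idn C x \<in> Hom C x x"
    and Cmp_closed: "\<lbrakk>f \<in> Hom C x y; g \<in> Hom C y z\<rbrakk> \<Longrightarrow> g \<odot> f \<in> Hom C x z"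
    and Cmp_assoc: "\<lbrakk>f \<in> Hom C w x; g \<in> Hom C x y; h \<in> Hom C y z\<rbrakk>
      \<Longrightarrow> (h \<odot> g) \<odot> f = h \<odot> (g \<odot> f)"
    and Cmp_Idn_right: "f \<in> Hom C x y \<Longrightarrow> f \<odot> Idn C x = f"
    and Cmp_Idn_left: "f \<in> Hom C x y \<Longrightarrow> Idn C y \<odot> f = f"

record ('o1, 'm1, 'o2, 'm2) functor_data =
  on_Ob :: "'o1 \<Rightarrow> 'o2"
  on_Mor :: "'m1 \<Rightarrow> 'm2"

locale category_functor = A: category A + B: category B
  for A :: "('o1, 'm1, 'y) category_data_scheme"
    and B :: "('o2, 'm2, 'z) category_data_scheme"
    and F :: "('o1, 'm1, 'o2, 'm2) functor_data" +
  assumes on_Ob_closed: "x \<in> Ob A \<Longrightarrow> on_Ob F x \<in> Ob B"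
    and on_Mor_closed: "f \<in> Hom A x y \<Longrightarrow> on_Mor F f \<in> Hom B (on_Ob F x) (on_Ob F y)"
    and on_Mor_Idn: "x \<in> Ob A \<Longrightarrow> on_Mor F (Idn A x) = Idn B (on_Ob F x)"
    and on_Mor_Cmp: "\<lbrakk>f \<in> Hom A x y; g \<in> Hom A y z\<rbrakk>
      \<Longrightarrow> on_Mor F (g \<odot>\<^bsub>A\<^esub> f) = on_Mor F g \<odot>\<^bsub>B\<^esub> on_Mor F f"

text \<open>
  \<open>is_left_adjoint D M L R\<close>: the functor \<open>L : D \<rightarrow> M\<close> is left adjoint to \<open>R : M \<rightarrow> D\<close>, i.e. there are
  bijections \<open>\<phi> d m : M(L d, m) \<rightarrow> D(d, R m)\<close> natural in both variables (naturality in \<open>d\<close> and in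
  \<open>m\<close> is expressed jointly; take \<open>u\<close> or \<open>v\<close> to be an identity to separate the two).
\<close>

definition is_left_adjoint ::
  "('do, 'dm, 'y) category_data_scheme \<Rightarrow> ('mo, 'mm, 'z) category_data_scheme \<Rightarrow>
   ('do, 'dm, 'mo, 'mm) functor_data \<Rightarrow> ('mo, 'mm, 'do, 'dm) functor_data \<Rightarrow> bool"
  where "is_left_adjoint D M L R \<longleftrightarrow>
    category_functor D M L \<and> category_functor M D R \<and>
    (\<exists>\<phi>. (\<forall>d\<in>Ob D. \<forall>m\<in>Ob M. bij_betw (\<phi> d m) (Hom M (on_Ob L d) m) (Hom D d (on_Ob R m))) \<and>
      (\<forall>d\<in>Ob D. \<forall>d'\<in>Ob D. \<forall>m\<in>Ob M. \<forall>m'\<in>Ob M.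
        \<forall>u\<in>Hom D d' d. \<forall>v\<in>Hom M m m'. \<forall>g\<in>Hom M (on_Ob L d) m.
          \<phi> d' m' (v \<odot>\<^bsub>M\<^esub> g \<odot>\<^bsub>M\<^esub> on_Mor L u) = on_Mor R v \<odot>\<^bsub>D\<^esub> \<phi> d m g \<odot>\<^bsub>D\<^esub> u))"


section \<open>Monoidal preorders and errors\<close>

text \<open>
  The carrier holds the 1-morphisms of the one-object 2-category, the monoid multiplication is their
  composition, \<open>\<one>\<close> is the identity 1-morphism of the single object, and \<open>a \<preceq> b\<close> says that there is
  a 2-morphism from \<open>a\<close> to \<open>b\<close>.
\<close>

record 'a preordered_monoid = "'a monoid" +
  pre_le :: "'a \<Rightarrow> 'a \<Rightarrow> bool"  (infixl "\<preceq>\<index>" 50)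

locale monoidal_preorder = monoid S
  for S :: "('a, 'z) preordered_monoid_scheme" (structure) +
  assumes pre_refl: "a \<in> carrier S \<Longrightarrow> a \<preceq> a"
    and pre_trans: "\<lbrakk>a \<preceq> b; b \<preceq> c; a \<in> carrier S; b \<in> carrier S; c \<in> carrier S\<rbrakk> \<Longrightarrow> a \<preceq> c"
    and mult_mono: "\<lbrakk>a \<preceq> a'; b \<preceq> b'; a \<in> carrier S; a' \<in> carrier S; b \<in> carrier S; b' \<in> carrier S\<rbrakk>
      \<Longrightarrow> a \<otimes> b \<preceq> a' \<otimes> b'"

definition is_bottom :: "('a, 'z) preordered_monoid_scheme \<Rightarrow> 'a \<Rightarrow> bool"
  where "is_bottom S b \<longleftrightarrow> b \<in> carrier S \<and> (\<forall>a\<in>carrier S. b \<preceq>\<^bsub>S\<^esub> a)"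

text \<open>
  A lax functor from \<open>D\<close>, seen as a 2-category with only identity 2-morphisms, to the one-object
  2-category \<open>S\<close>; the coherence conditions are vacuous because \<open>S\<close> is locally a preorder.
\<close>

locale flavoured_error = D: category D + S: monoidal_preorder S
  for D :: "('o, 'm, 'y) category_data_scheme"
    and S :: "('a, 'z) preordered_monoid_scheme"
    and Err :: "'m \<Rightarrow> 'a" +
  assumes one_bottom: "is_bottom S \<one>\<^bsub>S\<^esub>"
    and Err_closed: "f \<in> Mor D \<Longrightarrow> Err f \<in> carrier S"
    and Err_Cmp: "\<lbrakk>f \<in> Hom D x y; g \<in> Hom D y z\<rbrakk> \<Longrightarrow> Err g \<otimes>\<^bsub>S\<^esub> Err f \<preceq>\<^bsub>S\<^esub> Err (g \<odot>\<^bsub>D\<^esub> f)"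
    and Err_Idn: "x \<in> Ob D \<Longrightarrow> \<one>\<^bsub>S\<^esub> \<preceq>\<^bsub>S\<^esub> Err (Idn D x)"

text \<open>\<open>err_le D S Err x y z w\<close> renders the notation \<open>Err(x,y) \<le>\<^sub>S Err(z,w)\<close>.\<close>

definition err_le ::
  "('o, 'm, 'y) category_data_scheme \<Rightarrow> ('a, 'z) preordered_monoid_scheme \<Rightarrow> ('m \<Rightarrow> 'a) \<Rightarrow>
   'o \<Rightarrow> 'o \<Rightarrow> 'o \<Rightarrow> 'o \<Rightarrow> bool"
  where "err_le D S Err x y z w \<longleftrightarrow> (\<forall>f\<in>Hom D z w. \<exists>g\<in>Hom D x y. Err g \<preceq>\<^bsub>S\<^esub> Err f)"

text \<open>The functor called \<open>Inf\<close> in the notion of error minimiser is \<open>R\<close> here, as \<open>Inf\<close> is the lattice infimum in HOL.\<close>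

definition global_error_minimiser ::
  "('mo, 'mm, 'x) category_data_scheme \<Rightarrow> ('do, 'dm, 'y) category_data_scheme \<Rightarrow>
   ('mo, 'mm, 'do, 'dm) functor_data \<Rightarrow> ('a, 'z) preordered_monoid_scheme \<Rightarrow> ('dm \<Rightarrow> 'a) \<Rightarrow>
   'do \<Rightarrow> 'mo \<Rightarrow> bool"
  where "global_error_minimiser M D R S Err d x \<longleftrightarrow>
    x \<in> Ob M \<and> (\<forall>m\<in>Ob M. err_le D S Err d (on_Ob R x) d (on_Ob R m))"

end

theory Submission
  imports Defs
begin

text \<open>
  Every morphism \<open>d \<rightarrow> R m\<close> factors as \<open>R g\<close> after the unit \<open>d \<rightarrow> R (L d)\<close>. As the identity
  1-morphism is a bottom element, postcomposition cannot decrease the error, so the unit has the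
  smallest error among all morphisms from \<open>d\<close> into the image of \<open>R\<close>.
\<close>

text \<open>Bottomness gives \<open>\<one> \<preceq> Err g\<close>; multiplying by
  \<open>Err f\<close> on the right keeps the inequality, and laxness bounds the product by the
  error of the composite.\<close>

lemma (in flavoured_error) Err_le_Cmp:
  assumes f: "f \<in> Hom D x y" and g: "g \<in> Hom D y z"
  shows "Err f \<preceq>\<^bsub>S\<^esub> Err (g \<odot>\<^bsub>D\<^esub> f)"
proof -
  have Ef: "Err f \<in> carrier S" and Eg: "Err g \<in> carrier S"
    and Egf: "Err (g \<odot>\<^bsub>D\<^esub> f) \<in> carrier S"
    using f g D.Cmp_closed[OF f g] Err_closed unfolding Hom_def by auto
  have "\<one>\<^bsub>S\<^esub> \<preceq>\<^bsub>S\<^esub> Err g"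
    using one_bottom Eg unfolding is_bottom_def by blast
  then have "\<one>\<^bsub>S\<^esub> \<otimes>\<^bsub>S\<^esub> Err f \<preceq>\<^bsub>S\<^esub> Err g \<otimes>\<^bsub>S\<^esub> Err f"
    using Ef Eg by (intro S.mult_mono S.pre_refl S.one_closed)
  then have "Err f \<preceq>\<^bsub>S\<^esub> Err g \<otimes>\<^bsub>S\<^esub> Err f"
    using Ef by simp
  then show ?thesis
    using Err_Cmp[OF f g] Ef Eg Egf by (blast intro: S.pre_trans S.m_closed)
qed

text \<open>A Yoneda argument: naturality in the second variable makes \<open>\<phi> d\<close>
  determined by its value at the identity of \<open>L d\<close>, and surjectivity of
  \<open>\<phi> d m\<close> then reaches every \<open>f\<close>.\<close>

lemma left_adjoint_unit_factorisation:
  assumes adj: "is_left_adjoint D M L R" and d: "d \<in> Ob D"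
  obtains \<eta> where "\<eta> \<in> Hom D d (on_Ob R (on_Ob L d))"
    and "\<And>m f. \<lbrakk>m \<in> Ob M; f \<in> Hom D d (on_Ob R m)\<rbrakk>
      \<Longrightarrow> \<exists>g\<in>Hom M (on_Ob L d) m. f = on_Mor R g \<odot>\<^bsub>D\<^esub> \<eta>"
proof -
  interpret L: category_functor D M L
    using adj unfolding is_left_adjoint_def by blast
  interpret R: category_functor M D R
    using adj unfolding is_left_adjoint_def by blast
  obtain \<phi> where
    bij: "\<And>d m. \<lbrakk>d \<in> Ob D; m \<in> Ob M\<rbrakk>
      \<Longrightarrow> bij_betw (\<phi> d m) (Hom M (on_Ob L d) m) (Hom D d (on_Ob R m))"
    and nat: "\<And>d d' m m' u v g.
      \<lbrakk>d \<in> Ob D; d' \<in> Ob D; m \<in> Ob M; m' \<in> Ob M;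
       u \<in> Hom D d' d; v \<in> Hom M m m'; g \<in> Hom M (on_Ob L d) m\<rbrakk>
      \<Longrightarrow> \<phi> d' m' (v \<odot>\<^bsub>M\<^esub> g \<odot>\<^bsub>M\<^esub> on_Mor L u) = on_Mor R v \<odot>\<^bsub>D\<^esub> \<phi> d m g \<odot>\<^bsub>D\<^esub> u"
    using adj unfolding is_left_adjoint_def by blast
  \<comment> \<open>The unit of the adjunction at \<open>d\<close>, as the transpose of an
    identity.\<close>
  define \<eta> where "\<eta> = \<phi> d (on_Ob L d) (Idn M (on_Ob L d))"
  have Ld: "on_Ob L d \<in> Ob M"
    using d by (rule L.on_Ob_closed)
  have id: "Idn M (on_Ob L d) \<in> Hom M (on_Ob L d) (on_Ob L d)"
    using Ld by (rule L.B.Idn_closed)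
  have \<eta>: "\<eta> \<in> Hom D d (on_Ob R (on_Ob L d))"
    unfolding \<eta>_def using bij_betw_apply[OF bij[OF d Ld] id] .
  have "\<exists>g\<in>Hom M (on_Ob L d) m. f = on_Mor R g \<odot>\<^bsub>D\<^esub> \<eta>"
    if m: "m \<in> Ob M" and f: "f \<in> Hom D d (on_Ob R m)" for m f
  proof -
    obtain g where g: "g \<in> Hom M (on_Ob L d) m" and fg: "f = \<phi> d m g"
      using bij[OF d m] f unfolding bij_betw_def by blast
    \<comment> \<open>Joint naturality with \<open>u\<close> the identity of \<open>d\<close>,
      \<open>v\<close> the morphism \<open>g\<close>, and the identity of \<open>L d\<close> as the
      morphism being transposed.\<close>
    have "on_Mor R g \<odot>\<^bsub>D\<^esub> \<eta> \<odot>\<^bsub>D\<^esub> Idn D d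
        = \<phi> d m (g \<odot>\<^bsub>M\<^esub> Idn M (on_Ob L d) \<odot>\<^bsub>M\<^esub> on_Mor L (Idn D d))"
      unfolding \<eta>_def by (rule nat[OF d d Ld m L.A.Idn_closed[OF d] g id, symmetric])
    also have "\<dots> = f"
      using L.on_Mor_Idn[OF d] L.B.Cmp_Idn_right[OF g] fg by simp
    \<comment> \<open>This rewrites the left end of the chain, removing the identity that naturality
      left there.\<close>
    also have "on_Mor R g \<odot>\<^bsub>D\<^esub> \<eta> \<odot>\<^bsub>D\<^esub> Idn D d = on_Mor R g \<odot>\<^bsub>D\<^esub> \<eta>"
      using L.A.Cmp_closed[OF \<eta> R.on_Mor_closed[OF g]] by (rule L.A.Cmp_Idn_right)
    finally show ?thesis
      using g by blast
  qed
  with \<eta> show thesis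
    by (rule that)
qed

theorem corollary3p10:
  fixes M :: "('mo, 'mm) category_data"
    and D :: "('do, 'dm) category_data"
    and InfF :: "('mo, 'mm, 'do, 'dm) functor_data"
    and AlgF :: "('do, 'dm, 'mo, 'mm) functor_data"
  assumes "category M"
    and "category D"
    and "category_functor M D InfF"
    and "category_functor D M AlgF"
    and "is_left_adjoint D M AlgF InfF"
  shows "\<forall>d\<in>Ob D. \<forall>(S :: 's preordered_monoid) (Err :: 'dm \<Rightarrow> 's).
    monoidal_preorder S \<longrightarrow> is_bottom S \<one>\<^bsub>S\<^esub> \<longrightarrow> flavoured_error D S Err \<longrightarrow>
    global_error_minimiser M D InfF S Err d (on_Ob AlgF d)"
proof (intro ballI allI impI)
  fix d and S :: "'s preordered_monoid" and Err :: "'dm \<Rightarrow> 's"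
  assume d: "d \<in> Ob D" and "flavoured_error D S Err"
  then interpret flavoured_error D S Err by blast
  interpret L: category_functor D M AlgF by fact
  interpret R: category_functor M D InfF by fact
  \<comment> \<open>Both properties of \<open>\<eta>\<close> come from the adjunction alone;
    \<open>S\<close> and \<open>Err\<close> enter only in the inequality that follows.\<close>
  obtain \<eta> where \<eta>: "\<eta> \<in> Hom D d (on_Ob InfF (on_Ob AlgF d))"
    and factor: "\<And>m f. \<lbrakk>m \<in> Ob M; f \<in> Hom D d (on_Ob InfF m)\<rbrakk>
      \<Longrightarrow> \<exists>g\<in>Hom M (on_Ob AlgF d) m. f = on_Mor InfF g \<odot>\<^bsub>D\<^esub> \<eta>"
    using left_adjoint_unit_factorisation[OF \<open>is_left_adjoint D M AlgF InfF\<close> d] by blast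
  \<comment> \<open>Uniform in \<open>m\<close> and \<open>f\<close>: the existential in
    \<open>err_le\<close> has the same witness \<open>\<eta>\<close> throughout.\<close>
  have "Err \<eta> \<preceq>\<^bsub>S\<^esub> Err f" if "m \<in> Ob M" "f \<in> Hom D d (on_Ob InfF m)" for m f
    using factor[OF that] Err_le_Cmp[OF \<eta> R.on_Mor_closed] by blast
  then show "global_error_minimiser M D InfF S Err d (on_Ob AlgF d)"
    unfolding global_error_minimiser_def err_le_def
    using \<eta> L.on_Ob_closed[OF d] by blast
qed

end
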